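(* Let $t\in\mathbb{N}$. There exists $n_0(t)$ such that for all $n\ge n_0(t)$, if $\mathcal{F}\subseteq\mathcal{M}_{2n-1}$ is $t$-intersecting, then $|\mathcal{F}|\le(2(n-t)-1)!!$.
   Context: $\mathcal{M}_{2n-1}$ is the set of near-perfect matchings of the complete graph $K_{2n-1}$ (matchings with $n-1$ edges). A family $\mathcal{F}\subseteq\mathcal{M}_{2n-1}$ is $t$-intersecting if $|m\cap m'|\ge t$ for all $m,m'\in\mathcal{F}$. $(2k-1)!!=1\cdot3\cdots(2k-1)$. *)

theory Defs
  imports Main
begin

definition complete_edges :: "nat \<Rightarrow> nat set set" where
  "complete_edges m = {e. e \<subseteq> {0..<m} \<and> card e = 2}"

definition is_matching :: "nat \<Rightarrow> nat set set \<Rightarrow> bool" where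
  "is_matching m M \<longleftrightarrow> M \<subseteq> complete_edges m \<and>
     (\<forall>e\<in>M. \<forall>f\<in>M. e \<noteq> f \<longrightarrow> e \<inter> f = {})"

definition near_perfect_matchings :: "nat \<Rightarrow> nat set set set" where
  "near_perfect_matchings n =
     {M. is_matching (2*n - 1) M \<and> card M = n - 1}"

definition t_intersecting :: "nat \<Rightarrow> 'a set set \<Rightarrow> bool" where
  "t_intersecting t F \<longleftrightarrow> (\<forall>m\<in>F. \<forall>m'\<in>F. card (m \<inter> m') \<ge> t)"

fun dfact :: "nat \<Rightarrow> nat" where
  "dfact 0 = 1"
| "dfact (Suc 0) = 1"
| "dfact (Suc (Suc k)) = Suc (Suc k) * dfact k"

end

theory Submission
  imports Defs "HOL-Computational_Algebra.Nth_Powers" "HOL-Real_Asymp.Real_Asymp"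
begin

text \<open>
  Call a set of edges a \<open>t\<close>-cover if it meets every member of \<open>F\<close> in at least \<open>t\<close> edges.
  If \<open>S\<close> is not a cover, some \<open>B \<in> F\<close> forces every member of \<open>F\<close> that contains \<open>S\<close> to
  contain one of the \<open>n - 1\<close> edges of \<open>B\<close> outside \<open>S\<close>, and each such edge cuts the number of
  extensions by a factor of about \<open>2n\<close>. So every branching step loses a factor of about \<open>2\<close>, and the
  members of \<open>F\<close> containing no cover of size less than \<open>q\<close> are negligible once \<open>q\<close> is a small power
  of \<open>n\<close>.

  If there is a small cover \<open>S0\<close>, every member of \<open>F\<close> contains some \<open>t\<close>-subset \<open>T\<close> of \<open>S0\<close>.
  Either every such \<open>T\<close> fails to lie in some small cover, and branching on that cover leaves
  at most \<open>q ^ (t + 1)\<close> extension sets of \<open>t + 1\<close> edges; or some \<open>T\<close> lies in all small covers, so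
  that \<open>F\<close> consists of matchings through \<open>T\<close> and negligibly many others. In the latter
  case a single \<open>B \<in> F\<close> not containing \<open>T\<close> already halves the number of members through \<open>T\<close>.
\<close>

section \<open>Perfect matchings of a finite set and odd double factorials\<close>

definition pair_partitions :: "'a set \<Rightarrow> 'a set set set" where
  "pair_partitions W = {M. (\<forall>e\<in>M. card e = 2) \<and> pairwise disjnt M \<and> \<Union>M = W}"

lemma finite_pair_partitions: "finite W \<Longrightarrow> finite (pair_partitions W)"
  by (rule finite_subset[of _ "Pow (Pow W)"]) (auto simp: pair_partitions_def)

lemma card_Union_pairs:
  assumes "finite M" "\<forall>e\<in>M. card e = 2" "pairwise disjnt M"
  shows "card (\<Union>M) = 2 * card M"
proof -
  have "card (\<Union>M) = sum card M"
    using assms by (intro card_Union_disjoint) (auto intro: card_ge_0_finite)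
  also have "\<dots> = (\<Sum>e\<in>M. 2)"
    using assms by (intro sum.cong) auto
  finally show ?thesis by simp
qed

text \<open>At \<open>k = 0\<close> truncated subtraction turns \<open>2 * k - 1\<close> into 0, so
  \<open>dfact 0 = 1\<close> stands in for (-1)!!.\<close>

lemma dfact_odd: "dfact (2 * Suc k - 1) = (2 * k + 1) * dfact (2 * k - 1)"
  by (cases k) auto

text \<open>Classify a partition by the partner \<open>w\<close> of the fixed point
  \<open>v\<close>. Deleting that pair leaves two points fewer, and the choices of \<open>w\<close>
  supply the factor in the double factorial recursion.\<close>

lemma pair_partitions_subset:
  assumes "v \<in> W"
  shows "pair_partitions W \<subseteq> (\<Union>w\<in>W - {v}. insert {v, w} ` pair_partitions (W - {v, w}))"
proof
  fix M assume "M \<in> pair_partitions W"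
  then have M: "\<forall>e\<in>M. card e = 2" "pairwise disjnt M" "\<Union>M = W"
    by (auto simp: pair_partitions_def)
  then obtain e where e: "e \<in> M" "v \<in> e" using assms by blast
  then obtain w where w: "e = {v, w}" "v \<noteq> w"
    using M(1) by (metis card_2_iff empty_iff insert_commute insert_iff)
  have "\<Union>(M - {e}) = W - {v, w}"
    using M(2,3) e(1) w(1) by (fastforce simp: pairwise_def disjnt_def)
  then have "M - {e} \<in> pair_partitions (W - {v, w})"
    using M by (auto simp: pair_partitions_def pairwise_def)
  moreover have "M = insert {v, w} (M - {e})" using e w by auto
  moreover have "w \<in> W - {v}" using M(3) e w by auto
  ultimately show "M \<in> (\<Union>w\<in>W - {v}. insert {v, w} ` pair_partitions (W - {v, w}))"
    by blast
qed

lemma card_pair_partitions_le: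
  assumes "finite W" "card W = 2 * k"
  shows "card (pair_partitions W) \<le> dfact (2 * k - 1)"
  using assms
proof (induction k arbitrary: W)
  case 0
  then have "M = {}" if "M \<in> pair_partitions W" for M
    using that by (cases "M = {}") (auto simp: pair_partitions_def, metis card.empty equals0I zero_neq_numeral)
  then have "pair_partitions W \<subseteq> {{}}" by blast
  then have "card (pair_partitions W) \<le> card {{} :: 'a set set}"
    by (intro card_mono) auto
  then show ?case by simp
next
  case (Suc k)
  then obtain v where v: "v \<in> W" by fastforce
  have step: "card (insert {v, w} ` pair_partitions (W - {v, w})) \<le> dfact (2 * k - 1)"
    if "w \<in> W - {v}" for w
  proof -
    have "card (W - {v, w}) = 2 * k"
      using Suc.prems that v by (subst card_Diff_subset) auto
    then have "card (pair_partitions (W - {v, w})) \<le> dfact (2 * k - 1)"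
      using Suc.IH Suc.prems by blast
    then show ?thesis
      using card_image_le[OF finite_pair_partitions] Suc.prems(1)
      by (meson finite_Diff le_trans)
  qed
  have "card (pair_partitions W) \<le>
      card (\<Union>w\<in>W - {v}. insert {v, w} ` pair_partitions (W - {v, w}))"
    using Suc.prems(1) by (intro card_mono pair_partitions_subset v) (auto intro: finite_pair_partitions)
  also have "\<dots> \<le> (\<Sum>w\<in>W - {v}. card (insert {v, w} ` pair_partitions (W - {v, w})))"
    using Suc.prems(1) by (intro card_UN_le) auto
  also have "\<dots> \<le> (\<Sum>w\<in>W - {v}. dfact (2 * k - 1))"
    by (intro sum_mono step)
  also have "\<dots> = dfact (2 * Suc k - 1)"
    using Suc.prems v unfolding dfact_odd by simp
  finally show ?case .
qed

section \<open>Near-perfect matchings through a given set of edges\<close>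

lemma near_perfect_matchingD:
  assumes "M \<in> near_perfect_matchings n"
  shows "finite M" "card M = n - 1" "\<forall>e\<in>M. card e = 2" "pairwise disjnt M"
    "\<Union>M \<subseteq> {0..<2 * n - 1}"
proof -
  have sub: "M \<subseteq> Pow {0..<2 * n - 1}"
    using assms by (auto simp: near_perfect_matchings_def is_matching_def complete_edges_def)
  then show "finite M" by (rule finite_subset) simp
  show "\<Union>M \<subseteq> {0..<2 * n - 1}" using sub by auto
qed (use assms in \<open>auto simp: near_perfect_matchings_def is_matching_def complete_edges_def
        pairwise_def disjnt_def\<close>)

lemma finite_near_perfect_matchings: "finite (near_perfect_matchings n)"
  by (rule finite_subset[of _ "Pow (Pow {0..<2 * n - 1})"])
    (use near_perfect_matchingD(5) in fastforce, simp)

text \<open>A near-perfect matching misses exactly one vertex. Choosing that vertex among the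
  \<open>2 * k + 1\<close> vertices off \<open>S\<close> and then pairing up the rest gives (2k+1)
  (2k-1)!! = (2k+1)!!.\<close>

lemma card_extensions_le:
  "card {M \<in> near_perfect_matchings n. S \<subseteq> M} \<le> dfact (2 * (n - card S) - 1)"
proof (cases "\<exists>M\<in>near_perfect_matchings n. S \<subseteq> M \<and> n > 0")
  case False
  show ?thesis
  \<comment> \<open>For \<open>n = 0\<close> truncated subtraction leaves only the empty matching,
    and the bound is \<open>dfact 0 = 1\<close>.\<close>
  proof (cases "n = 0")
    case True
    then have "{M \<in> near_perfect_matchings n. S \<subseteq> M} \<subseteq> {{}}"
      using near_perfect_matchingD(1,2)[of _ n] by auto
    then have "card {M \<in> near_perfect_matchings n. S \<subseteq> M} \<le> card {{} :: nat set set}"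
      by (intro card_mono) auto
    then show ?thesis using True by simp
  next
    case False
    then have "{M \<in> near_perfect_matchings n. S \<subseteq> M} = {}"
      using \<open>\<not> (\<exists>M\<in>_. _)\<close> by auto
    then show ?thesis by (simp only: card.empty zero_le)
  qed
next
  case True
  then obtain M0 where M0: "M0 \<in> near_perfect_matchings n" "S \<subseteq> M0" and n: "n > 0" by blast
  note D = near_perfect_matchingD[OF M0(1)]
  let ?V = "{0..<2 * n - 1}"
  have finS: "finite S" using M0(2) D(1) finite_subset by blast
  have cUS: "card (\<Union>S) = 2 * card S"
    using M0(2) D finS by (intro card_Union_pairs) (auto intro: pairwise_subset)
  have US: "\<Union>S \<subseteq> ?V" using M0(2) D(5) by auto
  have sn: "card S \<le> n - 1" using card_mono[OF D(1) M0(2)] D(2) by simp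
  define k where "k = n - 1 - card S"
  have cW: "card (?V - \<Union>S) = 2 * k + 1"
    using US cUS sn n finite_subset[OF US] by (subst card_Diff_subset) (auto simp: k_def)
  have sub: "{M \<in> near_perfect_matchings n. S \<subseteq> M} \<subseteq>
      (\<Union>v\<in>?V - \<Union>S. (\<union>) S ` pair_partitions (?V - \<Union>S - {v}))"
  proof
    fix M assume "M \<in> {M \<in> near_perfect_matchings n. S \<subseteq> M}"
    then have M: "M \<in> near_perfect_matchings n" "S \<subseteq> M" by auto
    note E = near_perfect_matchingD[OF M(1)]
    have "card (\<Union>M) = 2 * (n - 1)"
      using card_Union_pairs[OF E(1,3,4)] E(2) by simp
    then have "card (?V - \<Union>M) = 1"
      using E(5) n finite_subset[OF E(5)] by (subst card_Diff_subset) auto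
    then obtain v where v: "?V - \<Union>M = {v}" by (auto simp: card_1_singleton_iff)
    then have UM: "\<Union>M = ?V - {v}" using E(5) by auto
    have "\<Union>(M - S) = \<Union>M - \<Union>S"
      using E(4) M(2) by (fastforce simp: pairwise_def disjnt_def)
    then have "M - S \<in> pair_partitions (?V - \<Union>S - {v})"
      using E UM by (auto simp: pair_partitions_def pairwise_def)
    moreover have "M = S \<union> (M - S)" using M(2) by auto
    moreover have "v \<in> ?V - \<Union>S" using v M(2) by auto
    ultimately show "M \<in> (\<Union>v\<in>?V - \<Union>S. (\<union>) S ` pair_partitions (?V - \<Union>S - {v}))"
      by blast
  qed
  have step: "card ((\<union>) S ` pair_partitions (?V - \<Union>S - {v})) \<le> dfact (2 * k - 1)"
    if "v \<in> ?V - \<Union>S" for v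
  proof -
    have "card (?V - \<Union>S - {v}) = 2 * k"
      using that cW by (simp add: card_Diff_singleton)
    then have "card (pair_partitions (?V - \<Union>S - {v})) \<le> dfact (2 * k - 1)"
      by (intro card_pair_partitions_le) auto
    then show ?thesis
      using card_image_le[OF finite_pair_partitions] by (meson finite_Diff finite_atLeastLessThan le_trans)
  qed
  have "card {M \<in> near_perfect_matchings n. S \<subseteq> M} \<le>
      card (\<Union>v\<in>?V - \<Union>S. (\<union>) S ` pair_partitions (?V - \<Union>S - {v}))"
    by (intro card_mono sub) (auto intro: finite_pair_partitions)
  also have "\<dots> \<le> (\<Sum>v\<in>?V - \<Union>S. card ((\<union>) S ` pair_partitions (?V - \<Union>S - {v})))"
    by (intro card_UN_le) auto
  also have "\<dots> \<le> (\<Sum>v\<in>?V - \<Union>S. dfact (2 * k - 1))"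
    by (intro sum_mono step)
  also have "\<dots> = dfact (2 * Suc k - 1)"
    unfolding dfact_odd sum_constant cW by simp
  also have "Suc k = n - card S" using sn n by (simp add: k_def)
  finally show ?thesis .
qed

section \<open>Branching and covers\<close>

lemma card_supersets_le_branching:
  assumes "finite F" "finite X"
    and meets: "\<And>A. A \<in> F \<Longrightarrow> S \<subseteq> A \<Longrightarrow> A \<inter> (X - S) \<noteq> {}"
    and bound: "\<And>e. e \<in> X - S \<Longrightarrow> card {A \<in> F. insert e S \<subseteq> A} \<le> c"
  shows "card {A \<in> F. S \<subseteq> A} \<le> card X * c"
proof -
  have "{A \<in> F. S \<subseteq> A} \<subseteq> (\<Union>e\<in>X - S. {A \<in> F. insert e S \<subseteq> A})"
    using meets by fastforce
  then have "card {A \<in> F. S \<subseteq> A} \<le> card (\<Union>e\<in>X - S. {A \<in> F. insert e S \<subseteq> A})"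
    using assms(1,2) by (intro card_mono) auto
  also have "\<dots> \<le> (\<Sum>e\<in>X - S. card {A \<in> F. insert e S \<subseteq> A})"
    using assms(2) by (intro card_UN_le) auto
  also have "\<dots> \<le> (\<Sum>e\<in>X - S. c)"
    by (intro sum_mono bound)
  also have "\<dots> \<le> card X * c"
    using assms(2) by (simp add: card_mono)
  finally show ?thesis .
qed

definition t_cover :: "nat \<Rightarrow> 'a set set \<Rightarrow> 'a set \<Rightarrow> bool" where
  "t_cover t F C \<longleftrightarrow> finite C \<and> (\<forall>A\<in>F. t \<le> card (A \<inter> C))"

lemma not_subset_meets:
  assumes "finite S" "card (S \<inter> X) < t" "t \<le> card (A \<inter> X)"
  shows "A \<inter> (X - S) \<noteq> {}"
proof
  assume "A \<inter> (X - S) = {}"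
  then have "card (A \<inter> X) \<le> card (S \<inter> X)"
    using assms(1) by (intro card_mono) auto
  then show False using assms by simp
qed

text \<open>Induction on \<open>r\<close>, the number of branching steps until \<open>S\<close> has
  \<open>q\<close> elements. While \<open>r > 0\<close>, a cover \<open>S\<close> is too small to
  lie in a counted set; if \<open>S\<close> is no cover, a member of \<open>F\<close> meeting it in
  fewer than \<open>t\<close> elements offers at most \<open>b\<close> branches. At size
  \<open>q\<close> the bound \<open>c\<close> takes over.\<close>

lemma card_without_small_cover_le:
  assumes "finite F" "t_intersecting t F"
    and size: "\<And>A. A \<in> F \<Longrightarrow> finite A \<and> card A \<le> b"
    and ext: "\<And>S. finite S \<Longrightarrow> card S = q \<Longrightarrow> card {A \<in> F. S \<subseteq> A} \<le> c"
    and "finite S" "card S + r = q"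
  shows "card {A \<in> {A \<in> F. \<forall>C. t_cover t F C \<longrightarrow> card C < q \<longrightarrow> \<not> C \<subseteq> A}. S \<subseteq> A} \<le> b ^ r * c"
    (is "card {A \<in> ?G. S \<subseteq> A} \<le> _")
  using assms(5,6)
proof (induction r arbitrary: S)
  case 0
  have "card {A \<in> ?G. S \<subseteq> A} \<le> card {A \<in> F. S \<subseteq> A}"
    using assms(1) by (intro card_mono) auto
  also have "\<dots> \<le> c" using ext 0 by simp
  finally show ?case by simp
next
  case (Suc r)
  show ?case
  proof (cases "t_cover t F S")
    case True
    then have "{A \<in> ?G. S \<subseteq> A} = {}" using Suc.prems by auto
    then show ?thesis by (simp only: card.empty zero_le)
  next
    case False
    then obtain B where B: "B \<in> F" "card (S \<inter> B) < t"
      using Suc.prems(1) by (auto simp: t_cover_def not_le Int_commute)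
    have "card {A \<in> ?G. S \<subseteq> A} \<le> card B * (b ^ r * c)"
    proof (rule card_supersets_le_branching)
      fix A assume "A \<in> ?G" "S \<subseteq> A"
      then have "t \<le> card (A \<inter> B)"
        using assms(2) B(1) by (auto simp: t_intersecting_def)
      then show "A \<inter> (B - S) \<noteq> {}"
        using not_subset_meets Suc.prems(1) B(2) by blast
    next
      fix e assume "e \<in> B - S"
      then show "card {A \<in> ?G. insert e S \<subseteq> A} \<le> b ^ r * c"
        using Suc.prems by (intro Suc.IH) auto
    qed (use assms(1) size B(1) in auto)
    also have "\<dots> \<le> b * (b ^ r * c)"
      using size B(1) by (intro mult_right_mono) auto
    finally show ?thesis by (simp add: mult.assoc)
  qed
qed

section \<open>Choice of the branching depth and growth of double factorials\<close>

lemma exists_branching_depth: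
  "\<exists>n0. \<forall>n\<ge>n0. \<exists>q. t < q \<and> 4 * q \<le> n \<and> q ^ Suc t \<le> n
      \<and> 4 * (3 / 2) ^ t * real n ^ t \<le> (3 / 2) ^ q"
proof -
  have "\<forall>\<^sub>F q in sequentially. 4 * (3 / 2) ^ t * (real q + 1) ^ ((t + 2) * t) \<le> (3 / 2) ^ q"
    by real_asymp
  then obtain q0 where
    q0: "\<And>q. q \<ge> q0 \<Longrightarrow> 4 * (3 / 2) ^ t * (real q + 1) ^ ((t + 2) * t) \<le> (3 / 2) ^ q"
    by (auto simp: eventually_sequentially)
  \<comment> \<open>The bound \<open>t + 4\<close> passes to \<open>q\<close>, giving
    \<open>t < q\<close> and, through \<open>4 \<le> q\<close>, also
    \<open>4 * q \<le> q * q\<close>.\<close>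
  define q1 where "q1 = max q0 (t + 4)"
  show ?thesis
  proof (rule exI[of _ "q1 ^ (t + 2)"], intro allI impI)
    fix n assume n: "q1 ^ (t + 2) \<le> n"
    \<comment> \<open>The root keeps \<open>q ^ Suc t\<close> below \<open>n\<close>, while
      \<open>n < (q + 1) ^ (t + 2)\<close> makes \<open>n ^ t\<close> at most polynomial in
      \<open>q\<close>, hence smaller than the exponential.\<close>
    define q where "q = nth_root_nat (t + 2) n"
    have le: "q ^ (t + 2) \<le> n"
      unfolding q_def by (rule nth_root_nat_power_le) simp
    have lt: "n < (q + 1) ^ (t + 2)"
      using nth_root_nat_ge[of "t + 2" "q + 1" n] by (force simp: q_def not_le[symmetric])
    have "q1 \<le> q" unfolding q_def using n by (intro nth_root_nat_ge) auto
    then have q: "q0 \<le> q" "t + 4 \<le> q" by (auto simp: q1_def)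
    have "4 * q \<le> q * q" using q by simp
    also have "\<dots> \<le> q ^ (t + 2)"
      using q power_increasing[of 2 "t + 2" q] by (simp add: power2_eq_square)
    also note le
    finally have "4 * q \<le> n" .
    moreover have "q ^ Suc t \<le> n"
      by (rule le_trans[OF power_increasing le]) (use q in auto)
    moreover have "4 * (3 / 2) ^ t * real n ^ t \<le> (3 / 2) ^ q"
    proof -
      have "real n \<le> (real q + 1) ^ (t + 2)"
        using lt by (metis less_imp_le of_nat_1 of_nat_add of_nat_le_iff of_nat_power)
      then have "real n ^ t \<le> ((real q + 1) ^ (t + 2)) ^ t" by (intro power_mono) auto
      also have "\<dots> = (real q + 1) ^ ((t + 2) * t)" by (simp only: power_mult)
      finally have "4 * (3 / 2) ^ t * real n ^ t \<le> 4 * (3 / 2) ^ t * (real q + 1) ^ ((t + 2) * t)"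
        by (intro mult_left_mono) auto
      then show ?thesis using q0[OF q(1)] by (rule order_trans)
    qed
    ultimately show "\<exists>q. t < q \<and> 4 * q \<le> n \<and> q ^ Suc t \<le> n
        \<and> 4 * (3 / 2) ^ t * real n ^ t \<le> (3 / 2) ^ q"
      using q by (intro exI[of _ q]) simp
  qed
qed

lemma dfact_odd_diff:
  assumes "s < n"
  shows "dfact (2 * (n - s) - 1) = (2 * (n - s) - 1) * dfact (2 * (n - Suc s) - 1)"
proof -
  have "n - s = Suc (n - Suc s)" using assms by simp
  then show ?thesis using dfact_odd[of "n - Suc s"] by simp
qed

text \<open>The quotient of the two double factorials has \<open>d\<close> factors
  \<open>2 * (n - i) - 1\<close> with \<open>i < s + d\<close>. As \<open>i < n / 4\<close>, each is
  at least 3n/2.\<close>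

lemma dfact_odd_growth:
  assumes "4 * (s + d) \<le> n" "n > 0"
  shows "(3 / 2 * real n) ^ d * dfact (2 * (n - (s + d)) - 1) \<le> dfact (2 * (n - s) - 1)"
  using assms
proof (induction d)
  case (Suc d)
  have "(3 / 2 * real n) ^ Suc d * dfact (2 * (n - (s + Suc d)) - 1)
      = (3 / 2 * real n) ^ d * (3 / 2 * real n * dfact (2 * (n - Suc (s + d)) - 1))"
    by simp
  also have "\<dots> \<le> (3 / 2 * real n) ^ d * dfact (2 * (n - (s + d)) - 1)"
  proof (intro mult_left_mono)
    have "3 * n \<le> 2 * (2 * (n - (s + d)) - 1)" using Suc.prems by simp
    then have "3 / 2 * real n \<le> real (2 * (n - (s + d)) - 1)" by linarith
    moreover have "s + d < n" using Suc.prems by simp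
    ultimately show "3 / 2 * real n * dfact (2 * (n - Suc (s + d)) - 1) \<le> dfact (2 * (n - (s + d)) - 1)"
      unfolding dfact_odd_diff[OF \<open>s + d < n\<close>] of_nat_mult by (intro mult_right_mono) auto
  qed auto
  also have "\<dots> \<le> dfact (2 * (n - s) - 1)" using Suc by simp
  finally show ?case .
qed simp

section \<open>The bound for fixed \<open>n\<close> and depth \<open>q\<close>\<close>

lemma card_near_perfect_t_intersecting_le:
  assumes q: "t < q" "4 * q \<le> n" "q ^ Suc t \<le> n"
      "4 * (3 / 2) ^ t * real n ^ t \<le> (3 / 2) ^ q"
    and F: "F \<subseteq> near_perfect_matchings n" "t_intersecting t F"
  shows "card F \<le> dfact (2 * (n - t) - 1)"
proof -
  define g where "g s = dfact (2 * (n - s) - 1)" for s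
  define G where "G = {A \<in> F. \<forall>C. t_cover t F C \<longrightarrow> card C < q \<longrightarrow> \<not> C \<subseteq> A}"
  have finF: "finite F" using F(1) finite_near_perfect_matchings finite_subset by blast
  have size: "finite A" "card A = n - 1" if "A \<in> F" for A
    using near_perfect_matchingD(1,2) F(1) that by blast+
  have ext: "card {A \<in> F. S \<subseteq> A} \<le> g (card S)" for S
  proof -
    have "card {A \<in> F. S \<subseteq> A} \<le> card {M \<in> near_perfect_matchings n. S \<subseteq> M}"
      using F(1) finite_near_perfect_matchings by (intro card_mono) auto
    also have "\<dots> \<le> g (card S)" unfolding g_def by (rule card_extensions_le)
    finally show ?thesis .
  qed
  have gt: "g t = (2 * (n - t) - 1) * g (Suc t)"
    unfolding g_def using q by (intro dfact_odd_diff) simp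
  \<comment> \<open>Branching from the empty set through \<open>q\<close> levels. The constant 4
    reserves a quarter of the target \<open>g t\<close> for \<open>G\<close>.\<close>
  have G_small: "4 * card G \<le> g t"
  proof -
    have "card {A \<in> G. {} \<subseteq> A} \<le> (n - 1) ^ q * g q"
      unfolding G_def using finF F(2) size ext by (intro card_without_small_cover_le) auto
    then have "card G \<le> (n - 1) ^ q * g q" by simp
    also have "\<dots> \<le> n ^ q * g q" by (intro mult_right_mono power_mono) auto
    finally have "card G \<le> n ^ q * g q" .
    then have "real (card G) \<le> real (n ^ q * g q)" by (rule of_nat_mono)
    then have "real (4 * card G) \<le> 4 * real n ^ q * g q" by simp
    also have "4 * real n ^ q \<le> (3 / 2 * real n) ^ (q - t)"
    proof -
      \<comment> \<open>Growth is measured from \<open>g t\<close>, so only \<open>q - t\<close>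
        factors of 3/2 are gained; the factor \<open>(3 / 2) ^ t\<close> in the hypothesis on
        \<open>q\<close> compensates.\<close>
      have "(3 / 2) ^ t * (4 * real n ^ t) \<le> (3 / 2) ^ t * (3 / 2) ^ (q - t)"
        using q by (simp add: power_add[symmetric] mult_ac)
      then have "4 * real n ^ t \<le> (3 / 2) ^ (q - t)"
        by (rule mult_left_le_imp_le) simp
      then have "4 * real n ^ t * real n ^ (q - t) \<le> (3 / 2) ^ (q - t) * real n ^ (q - t)"
        by (rule mult_right_mono) simp
      moreover have "real n ^ q = real n ^ t * real n ^ (q - t)"
        using q by (simp add: power_add[symmetric])
      ultimately show ?thesis by (simp only: power_mult_distrib mult.assoc)
    qed
    then have "4 * real n ^ q * g q \<le> (3 / 2 * real n) ^ (q - t) * g q"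
      by (rule mult_right_mono) simp
    also have "\<dots> \<le> g t"
      using dfact_odd_growth[of t "q - t" n] q by (simp add: g_def)
    finally show ?thesis by simp
  qed
  show ?thesis
  proof (cases "F = G")
    case True
    then show ?thesis using G_small by (simp add: g_def)
  next
    case False
    then obtain S0 where S0: "t_cover t F S0" "card S0 < q"
      unfolding G_def by blast
    show ?thesis
    proof (cases "\<exists>T. card T = t \<and> finite T \<and> (\<forall>C. t_cover t F C \<longrightarrow> card C < q \<longrightarrow> T \<subseteq> C)")
      case True
      then obtain T where T: "card T = t" "finite T"
        "\<And>C. t_cover t F C \<Longrightarrow> card C < q \<Longrightarrow> T \<subseteq> C" by blast
      have FG: "F \<subseteq> {A \<in> F. T \<subseteq> A} \<union> G" unfolding G_def using T(3) by blast
      show ?thesis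
      \<comment> \<open>If all members contain \<open>T\<close>, the extension count for
        \<open>T\<close> is already the target.\<close>
      proof (cases "\<forall>B\<in>F. T \<subseteq> B")
        case True
        then have "{A \<in> F. T \<subseteq> A} = F" by auto
        then show ?thesis using ext[of T] T(1) by (simp add: g_def)
      next
        case False
        then obtain B where B: "B \<in> F" "\<not> T \<subseteq> B" by blast
        have small: "card (T \<inter> B) < t"
          using B(2) T(1,2) psubset_card_mono[of T "T \<inter> B"] by blast
        have "card {A \<in> F. T \<subseteq> A} \<le> card B * g (Suc t)"
        proof (rule card_supersets_le_branching)
          fix A assume "A \<in> F" "T \<subseteq> A"
          then have "t \<le> card (A \<inter> B)"
            using F(2) B(1) by (auto simp: t_intersecting_def)
          then show "A \<inter> (B - T) \<noteq> {}" using not_subset_meets T(2) small by blast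
        next
          fix e assume "e \<in> B - T"
          then show "card {A \<in> F. insert e T \<subseteq> A} \<le> g (Suc t)"
            using ext[of "insert e T"] T(1,2) by simp
        qed (use finF size B in auto)
        then have "4 * card {A \<in> F. T \<subseteq> A} \<le> 4 * (n - 1) * g (Suc t)"
          using size(2)[OF B(1)] by simp
        \<comment> \<open>Uses \<open>4 * t < n\<close>. The members through \<open>T\<close> take
          at most three quarters of \<open>g t\<close>, and \<open>G\<close> fits into the last
          quarter.\<close>
        also have "\<dots> \<le> 3 * (2 * (n - t) - 1) * g (Suc t)"
          using q by (intro mult_right_mono) auto
        also have "\<dots> = 3 * g t" by (simp add: gt)
        finally have "4 * card {A \<in> F. T \<subseteq> A} \<le> 3 * g t" .
        moreover have "card F \<le> card {A \<in> F. T \<subseteq> A} + card G"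
          using card_mono[OF _ FG] card_Un_le[of "{A \<in> F. T \<subseteq> A}" G] finF
          by (auto simp: G_def intro: le_trans)
        ultimately show ?thesis using G_small by (simp add: g_def)
      qed
    next
      case False
      \<comment> \<open>Since \<open>S0\<close> is a cover, each member contains some
        \<open>T\<close> in \<open>\<T>\<close>. There are at most \<open>q ^ t\<close> of these,
        and each costs another factor \<open>q\<close> by branching on a small cover that does not
        contain it.\<close>
      define \<T> where "\<T> = {T. T \<subseteq> S0 \<and> card T = t}"
      have finS0: "finite S0" using S0(1) by (simp add: t_cover_def)
      have fin\<T>: "finite \<T>" using finS0 by (simp add: \<T>_def)
      have branch: "card {A \<in> F. T \<subseteq> A} \<le> q * g (Suc t)" if "T \<in> \<T>" for T
      proof -
        have T: "card T = t" "finite T"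
          using that finS0 finite_subset by (auto simp: \<T>_def)
        then obtain C where C: "t_cover t F C" "card C < q" "\<not> T \<subseteq> C"
          using False by blast
        have small: "card (T \<inter> C) < t"
          using C(3) T psubset_card_mono[of T "T \<inter> C"] by blast
        have "card {A \<in> F. T \<subseteq> A} \<le> card C * g (Suc t)"
        proof (rule card_supersets_le_branching)
          fix A assume "A \<in> F" "T \<subseteq> A"
          then have "t \<le> card (A \<inter> C)" using C(1) by (auto simp: t_cover_def)
          then show "A \<inter> (C - T) \<noteq> {}" using not_subset_meets T(2) small by blast
        next
          fix e assume "e \<in> C - T"
          then show "card {A \<in> F. insert e T \<subseteq> A} \<le> g (Suc t)"
            using ext[of "insert e T"] T by simp
        qed (use finF C(1) in \<open>auto simp: t_cover_def\<close>)
        also have "\<dots> \<le> q * g (Suc t)" using C(2) by (intro mult_right_mono) auto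
        finally show ?thesis .
      qed
      have "F \<subseteq> (\<Union>T\<in>\<T>. {A \<in> F. T \<subseteq> A})"
      proof
        fix A assume A: "A \<in> F"
        then have "t \<le> card (A \<inter> S0)" using S0(1) by (simp add: t_cover_def)
        then obtain T where "T \<subseteq> A \<inter> S0" "card T = t"
          by (meson obtain_subset_with_card_n)
        then show "A \<in> (\<Union>T\<in>\<T>. {A \<in> F. T \<subseteq> A})" using A by (auto simp: \<T>_def)
      qed
      then have "card F \<le> card (\<Union>T\<in>\<T>. {A \<in> F. T \<subseteq> A})"
        using finF fin\<T> by (intro card_mono) auto
      also have "\<dots> \<le> (\<Sum>T\<in>\<T>. card {A \<in> F. T \<subseteq> A})"
        using fin\<T> by (rule card_UN_le)
      also have "\<dots> \<le> card \<T> * (q * g (Suc t))"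
        using branch sum_mono[of \<T> _ "\<lambda>_. q * g (Suc t)"] by simp
      also have "\<dots> \<le> q ^ t * (q * g (Suc t))"
      proof (intro mult_right_mono)
        have "card \<T> = card S0 choose t"
          unfolding \<T>_def using finS0 by (simp add: n_subsets)
        also have "\<dots> \<le> card S0 ^ t"
        proof (cases "t \<le> card S0")
          case True
          then show ?thesis by (rule binomial_le_pow)
        qed (simp add: binomial_eq_0)
        also have "\<dots> \<le> q ^ t" using S0(2) by (intro power_mono) auto
        finally show "card \<T> \<le> q ^ t" .
      qed simp
      also have "\<dots> = q ^ Suc t * g (Suc t)" by simp
      \<comment> \<open>From \<open>4 * t < 4 * q \<le> n\<close> follows
        \<open>n \<le> 2 * (n - t) - 1\<close>, so \<open>q ^ Suc t\<close> is at most the ratio of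
        \<open>g t\<close> to \<open>g (Suc t)\<close>.\<close>
      also have "\<dots> \<le> (2 * (n - t) - 1) * g (Suc t)"
        using q by (intro mult_right_mono) auto
      also have "\<dots> = dfact (2 * (n - t) - 1)" using gt by (simp add: g_def)
      finally show ?thesis .
    qed
  qed
qed

theorem mainTheorem10:
  fixes t :: nat
  shows "\<exists>n0. \<forall>n\<ge>n0. \<forall>F. F \<subseteq> near_perfect_matchings n \<and> t_intersecting t F
           \<longrightarrow> card F \<le> dfact (2*(n - t) - 1)"
  using exists_branching_depth[of t] card_near_perfect_t_intersecting_le by meson

end
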